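(* Let $\sigma(s)=\dfrac{s}{1-e^{-s}}$ for $s\neq0$ and $\sigma(0)=1$. Then the second derivative $\sigma''(s)$ is logarithmically concave on $(0,\infty)$. Moreover, the function $\sigma''(s)$ is decreasing on $(0,\infty)$ and $\sigma(s)$ is not concave on $(0,\infty)$; and for any given number $t>0$, the function $s\mapsto\sigma''(s)\sigma''(t-s)$ is logarithmically concave on $(0,t)$, increasing on $\bigl(0,\frac t2\bigr)$, and decreasing on $\bigl(\frac t2,t\bigr)$.
   Context: A positive function $f$ on an interval is logarithmically concave if $\ln f$ is concave on that interval. *)

theory Defs
  imports "HOL-Analysis.Analysis"
begin

definition sigma_fun :: "real \<Rightarrow> real" where
  "sigma_fun s = (if s = 0 then 1 else s / (1 - exp (- s)))"

text \<open>Positivity is part of the notion; in HOL, \<^const>\<open>ln\<close> is total and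
  extended by convention to nonpositive arguments.\<close>

definition log_concave_on :: "real set \<Rightarrow> (real \<Rightarrow> real) \<Rightarrow> bool" where
  "log_concave_on S f \<longleftrightarrow> (\<forall>x\<in>S. 0 < f x) \<and> concave_on S (\<lambda>x. ln (f x))"

abbreviation sigma_deriv2 :: "real \<Rightarrow> real" where
  "sigma_deriv2 \<equiv> deriv (deriv sigma_fun)"

end

theory Submission
  imports Defs
begin

text \<open>
  With \<open>x = s / 2\<close> one has \<open>sigma_fun s = x + x * coth x\<close>, so that
  \<open>\<sigma>'' s = (x * cosh x - sinh x) / (2 * sinh x ^ 3)\<close>.  Everything is read off from the
  logarithmic derivative \<open>\<psi>\<close> of this quotient as a function of \<open>x\<close> (\<open>sigma_logd\<close> below):

  \<^item> \<open>\<sigma>''\<close> decreases because \<open>\<psi>\<close> is negative;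
  \<^item> \<open>\<sigma>''\<close> is log-concave because \<open>\<psi>\<close> decreases;
  \<^item> the product \<open>\<sigma>'' s * \<sigma>'' (t - s)\<close> has logarithmic derivative \<open>\<psi>\<close> at \<open>s / 2\<close> minus
    \<open>\<psi>\<close> at \<open>(t - s) / 2\<close>, up to the factor 1/2.  This decreases in \<open>s\<close> and vanishes at
    \<open>s = t / 2\<close>.

  Negativity and monotonicity of \<open>\<psi>\<close> come from two-sided bounds for \<open>x\<close> by rational
  functions of \<open>cosh x\<close> and \<open>sinh x\<close>.  Indeed the sign of \<open>\<psi>'\<close> is that of the difference
  \<open>3 * (x * cosh x - sinh x)\<^sup>2 - (sinh x)\<^sup>2 * ((sinh x)\<^sup>2 - x\<^sup>2)\<close>, a quadratic polynomial in
  \<open>x\<close> once the hyperbolic functions are regarded as constants.  Its discriminant is a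
  perfect square, and its roots are
  \<open>(3 * cosh x * sinh x \<plusminus> 2 * sinh x ^ 3) / (4 * (sinh x)\<^sup>2 + 3)\<close>.  The argument \<open>x\<close> lies
  strictly between the two roots (\<open>hyperbolic_quadratic_bound\<close>), so that the quadratic is
  negative there.  The lower bound that gives \<open>\<psi> < 0\<close> also separates \<open>x\<close> from the smaller root.

  Concavity of \<open>\<sigma>\<close> itself is refuted at the explicit points 1, 2 and 3.
\<close>

section \<open>Rational bounds in hyperbolic functions\<close>

lemma gt_zero_of_deriv_pos:
  fixes f f' :: "real \<Rightarrow> real"
  assumes "f 0 = 0" and "\<And>x. (f has_real_derivative f' x) (at x)"
    and "\<And>x. 0 < x \<Longrightarrow> 0 < f' x" and "0 < x"
  shows "0 < f x"
proof -
  have "f 0 < f x"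
    using \<open>0 < x\<close>
  proof (rule DERIV_pos_imp_increasing_open)
    show "continuous_on {0..x} f"
      by (meson DERIV_isCont assms(2) continuous_at_imp_continuous_on)
  qed (use assms in blast)
  then show ?thesis
    using assms(1) by simp
qed

text \<open>
  Dividing by the factor of \<open>x\<close> eliminates \<open>x\<close> after one differentiation: the difference
  \<open>x - 3 * cosh x * sinh x / (2 * (sinh x)\<^sup>2 + 3)\<close> vanishes at 0, and the numerator of its
  derivative collapses to \<open>4 * sinh x ^ 4\<close>.
\<close>

lemma hyperbolic_lower_bound:
  fixes x :: real
  assumes "0 < x"
  shows "3 * cosh x * sinh x < x * (2 * (sinh x)\<^sup>2 + 3)"
proof -
  define d :: "real \<Rightarrow> real" where "d y = 2 * (sinh y)\<^sup>2 + 3" for y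
  have d: "0 < d y" for y
    unfolding d_def by (simp add: add_nonneg_pos)
  have "0 < x - 3 * cosh x * sinh x / d x"
  proof (rule gt_zero_of_deriv_pos[where
        f = "\<lambda>y. y - 3 * cosh y * sinh y / d y" and
        f' = "\<lambda>y. 4 * (sinh y) ^ 4 / (d y)\<^sup>2"])
    fix y :: real
    have "((\<lambda>y. y - 3 * cosh y * sinh y / d y) has_real_derivative
        1 - ((3 * sinh y * sinh y + 3 * cosh y * cosh y) * d y
          - 3 * cosh y * sinh y * (4 * sinh y * cosh y)) / (d y * d y)) (at y)"
      using d[of y] unfolding d_def
      by (auto intro!: derivative_eq_intros simp: algebra_simps power2_eq_square)
    moreover have "(d y)\<^sup>2 - ((3 * sinh y * sinh y + 3 * cosh y * cosh y) * d y
          - 3 * cosh y * sinh y * (4 * sinh y * cosh y)) = 4 * (sinh y) ^ 4"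
    proof -
      have "cosh y * cosh y = 1 + (sinh y)\<^sup>2"
        using cosh_square_eq[of y] by (simp add: power2_eq_square)
      then show ?thesis
        unfolding d_def by algebra
    qed
    moreover have "1 - a / (d y * d y) = ((d y)\<^sup>2 - a) / (d y)\<^sup>2" for a
      using d[of y] by (simp add: diff_divide_distrib power2_eq_square)
    ultimately show "((\<lambda>y. y - 3 * cosh y * sinh y / d y) has_real_derivative
        4 * (sinh y) ^ 4 / (d y)\<^sup>2) (at y)"
      by simp
  next
    fix y :: real
    assume "0 < y"
    then show "0 < 4 * sinh y ^ 4 / (d y)\<^sup>2"
      using d[of y] by simp
  qed (use assms in auto)
  then show ?thesis
    using d[of x] by (simp add: field_simps d_def)
qed

text \<open>
  The bound on \<open>x\<close> expressed here is the larger root of the quadratic.  As for the lower bound,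
  divide and differentiate; writing \<open>(sinh x)\<^sup>2 = (cosh x)\<^sup>2 - 1\<close> turns the numerator of the
  derivative into \<open>2 * (sinh x)\<^sup>2\<close> times a cubic in \<open>cosh x\<close>, which factors as
  \<open>(cosh x - 1) * (2 * cosh x - 1)\<^sup>2\<close>.
\<close>

lemma hyperbolic_upper_bound:
  fixes x :: real
  assumes "0 < x"
  shows "x * (4 * (sinh x)\<^sup>2 + 3) < 3 * cosh x * sinh x + 2 * sinh x ^ 3"
proof -
  define d :: "real \<Rightarrow> real" where "d y = 4 * (sinh y)\<^sup>2 + 3" for y
  have d: "0 < d y" for y
    unfolding d_def by (simp add: add_nonneg_pos)
  define n :: "real \<Rightarrow> real" where "n y = 3 * cosh y * sinh y + 2 * sinh y ^ 3" for y
  have "0 < n x / d x - x"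
  proof (rule gt_zero_of_deriv_pos[where
        f = "\<lambda>y. n y / d y - y" and
        f' = "\<lambda>y. 2 * (sinh y)\<^sup>2 * (cosh y - 1) * (2 * cosh y - 1)\<^sup>2 / (d y)\<^sup>2"])
    fix y :: real
    let ?n' = "3 * sinh y * sinh y + 3 * cosh y * cosh y + 6 * (sinh y)\<^sup>2 * cosh y"
    have "((\<lambda>y. n y / d y - y) has_real_derivative
        (?n' * d y - n y * (8 * sinh y * cosh y)) / (d y * d y) - 1) (at y)"
      using d[of y] unfolding d_def n_def
      by (auto intro!: derivative_eq_intros simp: algebra_simps power2_eq_square)
    moreover have "?n' * d y - n y * (8 * sinh y * cosh y) - (d y)\<^sup>2
        = 2 * (sinh y)\<^sup>2 * (cosh y - 1) * (2 * cosh y - 1)\<^sup>2"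
    proof -
      have "cosh y * cosh y = 1 + (sinh y)\<^sup>2"
        using cosh_square_eq[of y] by (simp add: power2_eq_square)
      then show ?thesis
        unfolding d_def n_def by algebra
    qed
    moreover have "a / (d y * d y) - 1 = (a - (d y)\<^sup>2) / (d y)\<^sup>2" for a
      using d[of y] by (simp add: diff_divide_distrib power2_eq_square)
    ultimately show "((\<lambda>y. n y / d y - y) has_real_derivative
        2 * (sinh y)\<^sup>2 * (cosh y - 1) * (2 * cosh y - 1)\<^sup>2 / (d y)\<^sup>2) (at y)"
      by simp
  next
    fix y :: real
    assume "0 < y"
    then have "1 < cosh y"
      using cosh_real_strict_mono[of 0 y] by simp
    then show "0 < 2 * (sinh y)\<^sup>2 * (cosh y - 1) * (2 * cosh y - 1)\<^sup>2 / (d y)\<^sup>2"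
      using \<open>0 < y\<close> d[of y] by simp
  qed (use assms in \<open>auto simp: n_def\<close>)
  then show ?thesis
    using d[of x] by (simp add: field_simps d_def n_def)
qed

lemma mult_cosh_gt_sinh:
  fixes x :: real
  assumes "0 < x"
  shows "sinh x < x * cosh x"
proof -
  have "0 < x * cosh x - sinh x"
    by (rule gt_zero_of_deriv_pos[where f' = "\<lambda>y. y * sinh y"])
      (use assms in \<open>auto intro!: derivative_eq_intros\<close>)
  then show ?thesis by simp
qed

text \<open>
  As a quadratic in \<open>x\<close>, the difference of the two sides is \<open>4 * (sinh x)\<^sup>2 + 3\<close> times the
  product of the distances from \<open>x\<close> to its two roots.  The upper bound above is the larger
  root, and the lower bound above lies beyond the smaller one.
\<close>

lemma hyperbolic_quadratic_bound:
  fixes x :: real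
  assumes "0 < x"
  shows "3 * (x * cosh x - sinh x)\<^sup>2 < (sinh x)\<^sup>2 * ((sinh x)\<^sup>2 - x\<^sup>2)"
proof -
  define d where "d = 4 * (sinh x)\<^sup>2 + 3"
  have s: "0 < sinh x" using assms by simp
  have d: "0 < d"
    unfolding d_def by (simp add: add_nonneg_pos)
  have upper: "0 < 3 * cosh x * sinh x + 2 * sinh x ^ 3 - x * d"
    using hyperbolic_upper_bound[OF assms] by (simp add: d_def)
  have lower: "0 < x * d - 3 * cosh x * sinh x + 2 * sinh x ^ 3"
  proof -
    have "0 < x * (sinh x)\<^sup>2" "0 < sinh x ^ 3" using assms s by simp_all
    then show ?thesis
      using hyperbolic_lower_bound[OF assms] unfolding d_def distrib_left by linarith
  qed
  have "d * ((sinh x)\<^sup>2 * ((sinh x)\<^sup>2 - x\<^sup>2) - 3 * (x * cosh x - sinh x)\<^sup>2)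
      = (3 * cosh x * sinh x + 2 * sinh x ^ 3 - x * d)
        * (x * d - 3 * cosh x * sinh x + 2 * sinh x ^ 3)"
    using cosh_square_eq[of x] unfolding d_def by algebra
  also have "\<dots> > 0"
    using upper lower by simp
  finally show ?thesis
    using d by (simp add: zero_less_mult_iff)
qed

section \<open>The second derivative and its logarithmic derivative\<close>

lemma sigma_fun_hyperbolic:
  assumes "0 < s"
  shows "sigma_fun s = s / 2 + s / 2 * cosh (s / 2) / sinh (s / 2)"
proof -
  define q where "q = exp (s / 2)"
  have q: "1 < q" using assms by (simp add: q_def)
  then have "1 < q * q" by (simp add: less_1_mult)
  have "exp (- s) = inverse q * inverse q"
    unfolding q_def by (simp flip: exp_minus exp_add)
  then have lhs: "sigma_fun s = s / (1 - inverse q * inverse q)"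
    using assms by (simp add: sigma_fun_def)
  have sc: "sinh (s / 2) = (q - inverse q) / 2" "cosh (s / 2) = (q + inverse q) / 2"
    by (simp_all add: q_def sinh_def cosh_def exp_minus)
  show ?thesis
    unfolding lhs sc using q \<open>1 < q * q\<close> by (simp add: divide_simps) (simp add: algebra_simps)
qed

definition sigma_d2 :: "real \<Rightarrow> real" where
  "sigma_d2 x = (x * cosh x - sinh x) / (2 * sinh x ^ 3)"

definition sigma_logd :: "real \<Rightarrow> real" where
  "sigma_logd x = x * sinh x / (x * cosh x - sinh x) - 3 * cosh x / sinh x"

lemma has_real_derivative_half:
  fixes f :: "real \<Rightarrow> real"
  assumes "(f has_real_derivative D) (at (s / 2))"
  shows "((\<lambda>s. f (s / 2)) has_real_derivative D / 2) (at s)"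
proof -
  have "((\<lambda>s. s / 2) has_real_derivative 1 / 2) (at s)"
    by (auto intro!: derivative_eq_intros)
  from DERIV_chain2[OF assms this] show ?thesis by simp
qed

lemma sigma_deriv_eq:
  assumes "0 < s"
  shows "deriv sigma_fun s
    = (1 + cosh (s / 2) / sinh (s / 2) - s / 2 / (sinh (s / 2))\<^sup>2) / 2"
proof (rule DERIV_imp_deriv)
  have s: "0 < sinh (s / 2)" using assms by simp
  have "((\<lambda>x. x + x * cosh x / sinh x) has_real_derivative
      1 + cosh x / sinh x - x / (sinh x)\<^sup>2) (at x)" if "0 < x" for x :: real
  proof -
    have "((\<lambda>x. x + x * cosh x / sinh x) has_real_derivative
        1 + ((cosh x + x * sinh x) * sinh x - x * cosh x * cosh x) / (sinh x * sinh x)) (at x)"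
      using that by (auto intro!: derivative_eq_intros)
    moreover have "(cosh x + x * sinh x) * sinh x - x * cosh x * cosh x
        = cosh x * sinh x - x"
      using cosh_square_eq[of x] by algebra
    moreover have "1 + (cosh x * sinh x - x) / (sinh x * sinh x)
        = 1 + cosh x / sinh x - x / (sinh x)\<^sup>2"
      using that by (simp add: diff_divide_distrib power2_eq_square)
    ultimately show ?thesis
      by (simp only:)
  qed
  from has_real_derivative_half[OF this, of s] assms
  have "((\<lambda>s. s / 2 + s / 2 * cosh (s / 2) / sinh (s / 2)) has_real_derivative
      (1 + cosh (s / 2) / sinh (s / 2) - s / 2 / (sinh (s / 2))\<^sup>2) / 2) (at s)"
    by simp
  then show "(sigma_fun has_real_derivative
      (1 + cosh (s / 2) / sinh (s / 2) - s / 2 / (sinh (s / 2))\<^sup>2) / 2) (at s)"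
    by (rule has_field_derivative_transform_within_open[where S = "{0<..}"])
      (use assms in \<open>auto simp: sigma_fun_hyperbolic\<close>)
qed

lemma sigma_deriv2_eq:
  assumes "0 < s"
  shows "sigma_deriv2 s = sigma_d2 (s / 2)"
proof (rule DERIV_imp_deriv)
  have "((\<lambda>x. (1 + cosh x / sinh x - x / (sinh x)\<^sup>2) / 2) has_real_derivative
      2 * sigma_d2 x) (at x)" if "0 < x" for x :: real
  proof -
    have "((\<lambda>x. (1 + cosh x / sinh x - x / (sinh x)\<^sup>2) / 2) has_real_derivative
        ((sinh x * sinh x - cosh x * cosh x) / (sinh x * sinh x)
          - ((sinh x)\<^sup>2 - x * (2 * sinh x * cosh x)) / ((sinh x)\<^sup>2 * (sinh x)\<^sup>2)) / 2) (at x)"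
      using that by (auto intro!: derivative_eq_intros simp: diff_divide_distrib ac_simps)
    moreover have "sinh x * sinh x - cosh x * cosh x = - 1"
      using cosh_square_eq[of x] by (simp add: power2_eq_square)
    moreover have "(- 1 / (b * b) - (b\<^sup>2 - x * (2 * b * c)) / (b\<^sup>2 * b\<^sup>2)) / 2
        = 2 * ((x * c - b) / (2 * b ^ 3))" if "0 < b" for b c :: real
      using that by (simp add: field_simps power2_eq_square power3_eq_cube)
    note this[of "sinh x" "cosh x"]
    ultimately show ?thesis
      using that by (simp only: sigma_d2_def sinh_real_pos_iff simp_thms)
  qed
  from has_real_derivative_half[OF this, of s] assms
  have "((\<lambda>s. (1 + cosh (s / 2) / sinh (s / 2) - s / 2 / (sinh (s / 2))\<^sup>2) / 2)
      has_real_derivative sigma_d2 (s / 2)) (at s)"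
    by simp
  then show "(deriv sigma_fun has_real_derivative sigma_d2 (s / 2)) (at s)"
    by (rule has_field_derivative_transform_within_open[where S = "{0<..}"])
      (use assms in \<open>auto simp: sigma_deriv_eq\<close>)
qed

lemma sigma_deriv2_pos: "0 < s \<Longrightarrow> 0 < sigma_deriv2 s"
  using mult_cosh_gt_sinh[of "s / 2"] by (simp add: sigma_deriv2_eq sigma_d2_def)

lemma has_real_derivative_sigma_d2:
  assumes "0 < x"
  shows "(sigma_d2 has_real_derivative sigma_d2 x * sigma_logd x) (at x)"
proof -
  have s: "0 < sinh x" using assms by simp
  have n: "0 < x * cosh x - sinh x"
    using mult_cosh_gt_sinh[OF assms] by simp
  have "(sigma_d2 has_real_derivative
      (x * sinh x * (2 * sinh x ^ 3)
        - (x * cosh x - sinh x) * (6 * (sinh x)\<^sup>2 * cosh x))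
        / ((2 * sinh x ^ 3) * (2 * sinh x ^ 3))) (at x)"
    unfolding sigma_d2_def using s by (auto intro!: derivative_eq_intros simp: algebra_simps)
  moreover have "(a * (2 * b ^ 3) - n * (6 * b\<^sup>2 * c)) / ((2 * b ^ 3) * (2 * b ^ 3))
      = n / (2 * b ^ 3) * (a / n - 3 * c / b)" if "0 < b" "0 < n" for a b c n :: real
    using that by (simp add: field_simps power2_eq_square power3_eq_cube)
  note this[OF s n, of "x * sinh x" "cosh x"]
  ultimately show ?thesis
    by (simp only: sigma_d2_def sigma_logd_def)
qed

lemma has_real_derivative_sigma_deriv2:
  assumes "0 < s"
  shows "(sigma_deriv2 has_real_derivative sigma_deriv2 s * (sigma_logd (s / 2) / 2)) (at s)"
proof -
  have "((\<lambda>s. sigma_d2 (s / 2)) has_real_derivative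
      sigma_deriv2 s * (sigma_logd (s / 2) / 2)) (at s)"
    using has_real_derivative_half[OF has_real_derivative_sigma_d2, of s] assms
    by (simp add: sigma_deriv2_eq)
  then show ?thesis
    by (rule has_field_derivative_transform_within_open[where S = "{0<..}"])
      (use assms in \<open>auto simp: sigma_deriv2_eq\<close>)
qed

lemma sigma_logd_neg:
  assumes "0 < x"
  shows "sigma_logd x < 0"
proof -
  have "x * sinh x * sinh x < 3 * cosh x * (x * cosh x - sinh x)"
  proof -
    have "3 * cosh x * (x * cosh x - sinh x) - x * sinh x * sinh x
        = x * (2 * (sinh x)\<^sup>2 + 3) - 3 * cosh x * sinh x"
      using cosh_square_eq[of x] by algebra
    then show ?thesis
      using hyperbolic_lower_bound[OF assms] by linarith
  qed
  then show ?thesis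
    using assms mult_cosh_gt_sinh[OF assms]
    by (simp add: sigma_logd_def divide_simps algebra_simps)
qed

text \<open>
  For \<open>n = x * cosh x - sinh x\<close> one has \<open>n * n'' - n'\<^sup>2 = x\<^sup>2 - (sinh x)\<^sup>2\<close>, which gives
  \<open>sigma_logd' = (x\<^sup>2 - (sinh x)\<^sup>2) / n\<^sup>2 + 3 / (sinh x)\<^sup>2\<close>.
\<close>

lemma sigma_logd_strict_antimono:
  assumes "0 < x" "x < y"
  shows "sigma_logd y < sigma_logd x"
proof -
  have "\<exists>D. (sigma_logd has_real_derivative D) (at z) \<and> D < 0" if "0 < z" for z
  proof -
    define n where "n = z * cosh z - sinh z"
    have s: "0 < sinh z" using that by simp
    have n: "0 < n" using mult_cosh_gt_sinh[OF that] by (simp add: n_def)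
    have "(sigma_logd has_real_derivative
        ((sinh z + z * cosh z) * n - z * sinh z * (z * sinh z)) / (n * n)
          - 3 * (sinh z * sinh z - cosh z * cosh z) / (sinh z * sinh z)) (at z)"
      unfolding sigma_logd_def using s n unfolding n_def
      by (auto intro!: derivative_eq_intros simp: algebra_simps)
    moreover have "(sinh z + z * cosh z) * n - z * sinh z * (z * sinh z) = z\<^sup>2 - (sinh z)\<^sup>2"
      using cosh_square_eq[of z] unfolding n_def by algebra
    moreover have "sinh z * sinh z - cosh z * cosh z = -1"
      using cosh_square_eq[of z] by (simp add: power2_eq_square)
    ultimately have "(sigma_logd has_real_derivative
        (z\<^sup>2 - (sinh z)\<^sup>2) / n\<^sup>2 + 3 / (sinh z)\<^sup>2) (at z)"
      by (simp add: power2_eq_square)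
    moreover have "(z\<^sup>2 - (sinh z)\<^sup>2) / n\<^sup>2 + 3 / (sinh z)\<^sup>2 < 0"
    proof -
      have "(z\<^sup>2 - (sinh z)\<^sup>2) / n\<^sup>2 + 3 / (sinh z)\<^sup>2
          = (3 * n\<^sup>2 - (sinh z)\<^sup>2 * ((sinh z)\<^sup>2 - z\<^sup>2)) / (n\<^sup>2 * (sinh z)\<^sup>2)"
        using s n by (simp add: field_simps)
      also have "\<dots> < 0"
        using hyperbolic_quadratic_bound[OF that] s n
        by (simp add: n_def divide_less_0_iff)
      finally show ?thesis .
    qed
    ultimately show ?thesis by blast
  qed
  then show ?thesis
    using assms by (intro DERIV_neg_imp_decreasing[OF \<open>x < y\<close>]) force
qed

section \<open>Logarithmic derivatives and log-concavity\<close>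

lemma log_concave_on_if_logderiv_antimono:
  fixes g l :: "real \<Rightarrow> real"
  assumes "connected S"
    and pos: "\<And>x. x \<in> S \<Longrightarrow> 0 < g x"
    and deriv: "\<And>x. x \<in> S \<Longrightarrow> (g has_real_derivative g x * l x) (at x)"
    and anti: "\<And>x y. x \<in> S \<Longrightarrow> y \<in> S \<Longrightarrow> x \<le> y \<Longrightarrow> l y \<le> l x"
  shows "log_concave_on S g"
proof -
  have "convex_on S (\<lambda>x. - ln (g x))"
  proof (rule convex_on_realI[where f' = "\<lambda>x. - l x"])
    fix x assume "x \<in> S"
    then show "((\<lambda>x. - ln (g x)) has_real_derivative - l x) (at x)"
      using pos[of x] by (auto intro!: derivative_eq_intros deriv)
  qed (use assms in auto)
  then show ?thesis
    using pos by (simp add: log_concave_on_def concave_on_def)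
qed

text \<open>
  The reflected product has logarithmic derivative \<open>l s - l (t - s)\<close>, which is decreasing
  and changes sign at \<open>t / 2\<close>.  The statement on the right half interval follows from that on
  the left one by the symmetry \<open>s \<mapsto> t - s\<close>.
\<close>

lemma reflected_product:
  fixes g l :: "real \<Rightarrow> real" and t :: real
  assumes pos: "\<And>x. 0 < x \<Longrightarrow> 0 < g x"
    and deriv: "\<And>x. 0 < x \<Longrightarrow> (g has_real_derivative g x * l x) (at x)"
    and anti: "\<And>x y. 0 < x \<Longrightarrow> x < y \<Longrightarrow> l y < l x"
  shows "log_concave_on {0<..<t} (\<lambda>s. g s * g (t - s))"
    and "strict_mono_on {0<..<t / 2} (\<lambda>s. g s * g (t - s))"
    and "strict_antimono_on {t / 2<..<t} (\<lambda>s. g s * g (t - s))"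
proof -
  let ?p = "\<lambda>s. g s * g (t - s)"
  have p_deriv: "(?p has_real_derivative ?p s * (l s - l (t - s))) (at s)"
    if "0 < s" "s < t" for s
  proof -
    have "((\<lambda>s. g (t - s)) has_real_derivative g (t - s) * l (t - s) * (- 1)) (at s)"
      by (rule DERIV_chain2[OF deriv]) (use that in \<open>auto intro!: derivative_eq_intros\<close>)
    from DERIV_mult[OF deriv[OF \<open>0 < s\<close>] this] show ?thesis
      by (simp add: algebra_simps)
  qed
  have anti_le: "l y \<le> l x" if "0 < x" "x \<le> y" for x y
    using anti[of x y] that by (cases "x = y") auto
  show "log_concave_on {0<..<t} ?p"
  proof (rule log_concave_on_if_logderiv_antimono[where l = "\<lambda>s. l s - l (t - s)"])
    fix x y assume "x \<in> {0<..<t}" "y \<in> {0<..<t}" "x \<le> y"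
    then show "l y - l (t - y) \<le> l x - l (t - x)"
      using anti_le[of x y] anti_le[of "t - y" "t - x"] by simp
  qed (use p_deriv pos in auto)
  have increasing: "?p x < ?p y" if "0 < x" "x < y" "y < t / 2" for x y
  proof (rule DERIV_pos_imp_increasing[OF \<open>x < y\<close>])
    fix z assume "x \<le> z" "z \<le> y"
    with that have z: "0 < z" "z < t - z" by auto
    then have "0 < ?p z * (l z - l (t - z))"
      using pos[of z] pos[of "t - z"] anti[of z "t - z"] by simp
    then show "\<exists>D. (?p has_real_derivative D) (at z) \<and> 0 < D"
      using p_deriv[of z] z by auto
  qed
  then show "strict_mono_on {0<..<t / 2} ?p"
    by (auto simp: strict_mono_on_def)
  show "strict_antimono_on {t / 2<..<t} ?p"
  proof (rule monotone_onI)
    fix x y assume "x \<in> {t / 2<..<t}" "y \<in> {t / 2<..<t}" "x < y"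
    then show "?p y < ?p x"
      using increasing[of "t - y" "t - x"] by (simp add: mult.commute)
  qed
qed

section \<open>Failure of concavity, and the theorem\<close>

text \<open>
  The midpoint inequality fails at 1 and 3: with \<open>q = exp (- 1)\<close>, it would give
  \<open>q * (1 - q)\<^sup>2 \<le> 0\<close> after clearing denominators.
\<close>

lemma sigma_fun_not_concave: "\<not> concave_on {0<..} sigma_fun"
proof
  assume "concave_on {0<..} sigma_fun"
  from concave_onD[OF this, of "1 / 2" 1 3]
  have mid: "sigma_fun 1 + sigma_fun 3 \<le> 2 * sigma_fun 2"
    by simp
  define q :: real where "q = exp (- 1)"
  have q: "0 < q" "q < 1" by (simp_all add: q_def)
  have "sigma_fun 1 = 1 / (1 - q)" by (simp add: sigma_fun_def q_def)
  moreover have "sigma_fun 2 = 2 / ((1 - q) * (1 + q))"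
  proof -
    have "exp (- 2) = q ^ 2" by (simp add: q_def flip: exp_of_nat_mult)
    then show ?thesis by (simp add: sigma_fun_def power2_eq_square algebra_simps)
  qed
  moreover have "sigma_fun 3 = 3 / ((1 - q) * (1 + q + q\<^sup>2))"
  proof -
    have "exp (- 3) = q ^ 3" by (simp add: q_def flip: exp_of_nat_mult)
    moreover have "(1 - q) * (1 + q + q\<^sup>2) = 1 - q ^ 3" by algebra
    ultimately show ?thesis by (simp add: sigma_fun_def)
  qed
  ultimately have "1 / (1 - q) + 3 / ((1 - q) * (1 + q + q\<^sup>2)) - 4 / ((1 - q) * (1 + q)) \<le> 0"
    using mid by simp
  moreover have "1 / (1 - q) + 3 / ((1 - q) * (1 + q + q\<^sup>2)) - 4 / ((1 - q) * (1 + q))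
      = q * (1 - q)\<^sup>2 / ((1 - q) * (1 + q) * (1 + q + q\<^sup>2))"
  proof -
    have "1 + q + q\<^sup>2 > 0" using q by (simp add: add_pos_pos)
    then have "1 - q \<noteq> 0" "1 + q \<noteq> 0" "1 + q + q\<^sup>2 \<noteq> 0" using q by auto
    moreover have "1 / a + 3 / (a * c) - 4 / (a * b) = (b * c + 3 * b - 4 * c) / (a * b * c)"
      if "a \<noteq> 0" "b \<noteq> 0" "c \<noteq> 0" for a b c :: real
      using that by (simp add: field_simps)
    moreover have "(1 + q) * (1 + q + q\<^sup>2) + 3 * (1 + q) - 4 * (1 + q + q\<^sup>2) = q * (1 - q)\<^sup>2"
      by algebra
    ultimately show ?thesis by simp
  qed
  moreover have "0 < q * (1 - q)\<^sup>2 / ((1 - q) * (1 + q) * (1 + q + q\<^sup>2))"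
    using q by (simp add: add_pos_pos)
  ultimately show False by simp
qed

theorem mainTheorem2:
  shows "log_concave_on {0<..} sigma_deriv2
    \<and> strict_antimono_on {0<..} sigma_deriv2
    \<and> \<not> concave_on {0<..} sigma_fun
    \<and> (\<forall>t>0.
          log_concave_on {0<..<t} (\<lambda>s. sigma_deriv2 s * sigma_deriv2 (t - s))
        \<and> strict_mono_on {0<..<t / 2} (\<lambda>s. sigma_deriv2 s * sigma_deriv2 (t - s))
        \<and> strict_antimono_on {t / 2<..<t} (\<lambda>s. sigma_deriv2 s * sigma_deriv2 (t - s)))"
proof (intro conjI allI impI)
  let ?l = "\<lambda>s. sigma_logd (s / 2) / 2"
  have anti: "?l y < ?l x" if "0 < x" "x < y" for x y
    using sigma_logd_strict_antimono[of "x / 2" "y / 2"] that by simp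
  show "log_concave_on {0<..} sigma_deriv2"
  proof (rule log_concave_on_if_logderiv_antimono[where l = ?l])
    fix x y :: real assume "x \<in> {0<..}" "y \<in> {0<..}" "x \<le> y"
    then show "?l y \<le> ?l x"
      using anti[of x y] by (cases "x = y") auto
  qed (use sigma_deriv2_pos has_real_derivative_sigma_deriv2 in auto)
  show "strict_antimono_on {0<..} sigma_deriv2"
  proof (rule monotone_onI)
    fix x y :: real assume xy: "x \<in> {0<..}" "y \<in> {0<..}" "x < y"
    show "sigma_deriv2 y < sigma_deriv2 x"
    proof (rule DERIV_neg_imp_decreasing[OF \<open>x < y\<close>])
      fix z assume "x \<le> z" "z \<le> y"
      with xy have z: "0 < z" by auto
      then have "sigma_deriv2 z * ?l z < 0"
        using sigma_deriv2_pos[of z] sigma_logd_neg[of "z / 2"]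
        by (simp add: mult_less_0_iff)
      then show "\<exists>D. (sigma_deriv2 has_real_derivative D) (at z) \<and> D < 0"
        using has_real_derivative_sigma_deriv2[OF z] by blast
    qed
  qed
  show "\<not> concave_on {0<..} sigma_fun"
    by (rule sigma_fun_not_concave)
  fix t :: real
  note product = reflected_product[where g = sigma_deriv2 and l = ?l and t = t,
      OF sigma_deriv2_pos has_real_derivative_sigma_deriv2 anti]
  show "log_concave_on {0<..<t} (\<lambda>s. sigma_deriv2 s * sigma_deriv2 (t - s))"
    and "strict_mono_on {0<..<t / 2} (\<lambda>s. sigma_deriv2 s * sigma_deriv2 (t - s))"
    and "strict_antimono_on {t / 2<..<t} (\<lambda>s. sigma_deriv2 s * sigma_deriv2 (t - s))"
    by (rule product; assumption)+
qed

end
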